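(* Let $\Sigma_i$ be an MEIP agent with steady-state relation $k_i$, let $(\mathrm{u}_i^\star,\mathrm{y}_i^\star)$ and $(0,\mathrm{y}_{i,0})$ be steady-state input-output pairs of $\Sigma_i$, and let $m_i=K_i^\star(\mathrm{y}_i^\star)+K_i(0)$. Then the output $\mathbb{m}_i$ of the estimation procedure described in the context (run with its parameter $\beta_i>0$ in the first two experiments sufficiently small, and its third reference value sufficiently large, respectively sufficiently negative) is an upper bound on $m_i$, i.e. $m_i\le\mathbb{m}_i$.
   Context: The steady-state relation $k_i\subset\mathbb{R}^2$ of the SISO agent $\Sigma_i$ is the set of its steady-state input-output pairs $(\mathrm{u},\mathrm{y})$. MEIP (maximum equilibrium-independent passive) means that $\Sigma_i$ is passive with respect to each of its steady-state pairs and $k_i$ is maximally monotone (monotone: for two points of the relation, $\mathrm{u}_1<\mathrm{u}_2$ implies $\mathrm{y}_1\le\mathrm{y}_2$; maximal: not properly contained in a larger monotone relation). $K_i$ is a convex function with $\partial K_i=k_i$, and $K_i^\star(\mathrm{y})=\sup_{\mathrm{u}}\{\mathrm{u}\mathrm{y}-K_i(\mathrm{u})\}$. An experiment with parameters $(\beta,\mathrm{y}_{\mathrm{ref}})$, $\beta>0$: run $\Sigma_i$ in feedback with $u_i=-\beta(y_i-\mathrm{y}_{\mathrm{ref}})$, wait for convergence, and measure the steady-state input and output; i.e. the measured pair $(\mathrm{u},\mathrm{y})$ satisfies $(\mathrm{u},\mathrm{y})\in k_i$ and $\mathrm{u}=-\beta(\mathrm{y}-\mathrm{y}_{\mathrm{ref}})$.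 Procedure (the target output $\mathrm{y}_i^\star$ is known): 1. Run the experiment with $\beta=\beta_i$ small and $\mathrm{y}_{\mathrm{ref}}=1/\beta_i$; call the measured pair $(\mathrm{u}_{i,+},\mathrm{y}_{i,+})$. 2. Run the experiment with $\beta=\beta_i$ small and $\mathrm{y}_{\mathrm{ref}}=-1/\beta_i$; call the measured pair $(\mathrm{u}_{i,-},\mathrm{y}_{i,-})$. 3. If $\mathrm{y}_{i,+}<\mathrm{y}_i^\star$, run the experiment with $\beta=1$ and $\mathrm{y}_{\mathrm{ref}}\gg\mathrm{y}_i^\star$; otherwise run it with $\beta=1$ and $\mathrm{y}_{\mathrm{ref}}\ll\mathrm{y}_i^\star$. Call the measured pair $(\mathrm{u}_{i,2},\mathrm{y}_{i,2})$. 4. Sort $\{\mathrm{u}_{i,-},\mathrm{u}_{i,+},\mathrm{u}_{i,2}\}$ as $U_1\le U_2\le U_3$ and $\{\mathrm{y}_{i,-},\mathrm{y}_{i,+},\mathrm{y}_{i,2}\}$ as $Y_1\le Y_2\le Y_3$. 5. If $U_2>0$ put $\underline{\mathrm{y}_{i,0}}=Y_1$, $\overline{\mathrm{y}_{i,0}}=Y_2$; otherwise put $\underline{\mathrm{y}_{i,0}}=Y_2$, $\overline{\mathrm{y}_{i,0}}=Y_3$. 6. If $Y_2>\mathrm{y}_i^\star$ put $\underline{\mathrm{u}_i^\star}=U_1$, $\overline{\mathrm{u}_i^\star}=U_2$; otherwise put $\underline{\mathrm{u}_i^\star}=U_2$, $\overline{\mathrm{u}_i^\star}=U_3$. 7.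 Return $\mathbb{m}_i=\max\{\omega(\mathrm{y}_i^\star-\upsilon):\ \omega\in\{\underline{\mathrm{u}_i^\star},\overline{\mathrm{u}_i^\star}\},\ \upsilon\in\{\underline{\mathrm{y}_{i,0}},\overline{\mathrm{y}_{i,0}}\}\}$. "Sufficiently small" and "sufficiently large/negative" mean: there are thresholds, depending on $\Sigma_i$ and $\mathrm{y}_i^\star$, such that the assertion holds whenever $\beta_i$ is below, and $|\mathrm{y}_{\mathrm{ref}}|$ in step 3 is above, the respective threshold. *)

theory Defs
  imports "HOL-Analysis.Analysis"
begin

text \<open>A SISO agent \<open>x' = f(x,u), y = h(x,u)\<close>.\<close>

record 'x agent =
  dyn :: "'x \<Rightarrow> real \<Rightarrow> 'x"
  out :: "'x \<Rightarrow> real \<Rightarrow> real"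

definition steady_state_relation :: "'x::euclidean_space agent \<Rightarrow> (real \<times> real) set" where
  "steady_state_relation \<Sigma> = {(u, y). \<exists>x. dyn \<Sigma> x u = 0 \<and> y = out \<Sigma> x u}"

definition trajectory ::
  "'x::euclidean_space agent \<Rightarrow> (real \<Rightarrow> real) \<Rightarrow> (real \<Rightarrow> 'x) \<Rightarrow> (real \<Rightarrow> real) \<Rightarrow> bool" where
  "trajectory \<Sigma> u x y \<longleftrightarrow>
     (\<forall>t\<ge>0. (x has_vector_derivative dyn \<Sigma> (x t) (u t)) (at t within {0..})
            \<and> y t = out \<Sigma> (x t) (u t))"

text \<open>\<open>S\<close> is the storage function; the dissipation inequality
  \<open>dS(x(t))/dt \<le> (u(t) - us)(y(t) - ys)\<close> is required along every trajectory.\<close>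

definition passive_wrt :: "'x::euclidean_space agent \<Rightarrow> real \<Rightarrow> real \<Rightarrow> bool" where
  "passive_wrt \<Sigma> us ys \<longleftrightarrow>
     (\<exists>S :: 'x \<Rightarrow> real. (\<forall>x. 0 \<le> S x) \<and> S differentiable_on UNIV \<and>
        (\<forall>u x y. trajectory \<Sigma> u x y \<longrightarrow>
           (\<forall>t\<ge>0. \<forall>D. ((\<lambda>s. S (x s)) has_real_derivative D) (at t within {0..}) \<longrightarrow>
              D \<le> (u t - us) * (y t - ys))))"

definition monotone_relation :: "(real \<times> real) set \<Rightarrow> bool" where
  "monotone_relation k \<longleftrightarrow>
     (\<forall>u1 y1 u2 y2. (u1, y1) \<in> k \<longrightarrow> (u2, y2) \<in> k \<longrightarrow> u1 < u2 \<longrightarrow> y1 \<le> y2)"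

definition maximally_monotone :: "(real \<times> real) set \<Rightarrow> bool" where
  "maximally_monotone k \<longleftrightarrow>
     monotone_relation k \<and> (\<nexists>k'. monotone_relation k' \<and> k \<subset> k')"

definition MEIP :: "'x::euclidean_space agent \<Rightarrow> bool" where
  "MEIP \<Sigma> \<longleftrightarrow>
     (\<forall>(u, y) \<in> steady_state_relation \<Sigma>. passive_wrt \<Sigma> u y) \<and>
     maximally_monotone (steady_state_relation \<Sigma>)"

text \<open>Convex functions are extended-valued: if the inputs of the steady-state relation do not
  exhaust the reals, its integral function is infinite somewhere.\<close>

definition proper_convex :: "(real \<Rightarrow> ereal) \<Rightarrow> bool" where
  "proper_convex K \<longleftrightarrow>
     convex {(u, r :: real). K u \<le> ereal r} \<and> (\<forall>u. K u \<noteq> -\<infinity>) \<and> (\<exists>u. K u \<noteq> \<infinity>)"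

definition subdifferential :: "(real \<Rightarrow> ereal) \<Rightarrow> (real \<times> real) set" where
  "subdifferential K =
     {(u, y). \<bar>K u\<bar> \<noteq> \<infinity> \<and> (\<forall>v. K u + ereal (y * (v - u)) \<le> K v)}"

definition integral_function :: "(real \<Rightarrow> ereal) \<Rightarrow> (real \<times> real) set \<Rightarrow> bool" where
  "integral_function K k \<longleftrightarrow> proper_convex K \<and> subdifferential K = k"

definition convex_conjugate :: "(real \<Rightarrow> ereal) \<Rightarrow> real \<Rightarrow> ereal" where
  "convex_conjugate K y = (SUP u. ereal (u * y) - K u)"

text \<open>The pairs that can be measured once the agent under the feedback
  \<open>u = - \<beta> (y - yref)\<close> has converged, with gain \<open>\<beta>\<close> and reference \<open>yref\<close>.\<close>

definition measurable_pairs :: "'x::euclidean_space agent \<Rightarrow> real \<Rightarrow> real \<Rightarrow> (real \<times> real) set" where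
  "measurable_pairs \<Sigma> \<beta> yref =
     {(u, y). (u, y) \<in> steady_state_relation \<Sigma> \<and> u = - \<beta> * (y - yref)}"

text \<open>The estimate computed from the list \<open>us\<close> of the three measured inputs and the list
  \<open>ys\<close> of the three measured outputs, sorted with multiplicity. Indices start at 0, so \<open>U ! 1\<close> and \<open>Y ! 1\<close>
  are the middle values.\<close>

definition estimate :: "real \<Rightarrow> real list \<Rightarrow> real list \<Rightarrow> real" where
  "estimate ystar us ys =
     (let U = sort us; Y = sort ys;
          (y0_lo, y0_hi) = (if U ! 1 > 0 then (Y ! 0, Y ! 1) else (Y ! 1, Y ! 2));
          (us_lo, us_hi) = (if Y ! 1 > ystar then (U ! 0, U ! 1) else (U ! 1, U ! 2))
      in Max {\<omega> * (ystar - \<upsilon>) | \<omega> \<upsilon>. \<omega> \<in> {us_lo, us_hi} \<and> \<upsilon> \<in> {y0_lo, y0_hi}})"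

text \<open>\<open>m\<close> is a possible output of the procedure when the first two experiments use \<open>\<beta>\<close> and the
  third reference value lies beyond \<open>R\<close>, on the side prescribed by the first measurement.\<close>

definition procedure_output ::
  "'x::euclidean_space agent \<Rightarrow> real \<Rightarrow> real \<Rightarrow> real \<Rightarrow> real \<Rightarrow> bool" where
  "procedure_output \<Sigma> ystar \<beta> R m \<longleftrightarrow>
     (\<exists>up yp um ym u2 y2 yref.
        (up, yp) \<in> measurable_pairs \<Sigma> \<beta> (1 / \<beta>) \<and>
        (um, ym) \<in> measurable_pairs \<Sigma> \<beta> (- (1 / \<beta>)) \<and>
        (if yp < ystar then yref > R else yref < - R) \<and>
        (u2, y2) \<in> measurable_pairs \<Sigma> 1 yref \<and>
        m = estimate ystar [um, up, u2] [ym, yp, y2])"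

end

theory Submission
  imports Defs
begin

text \<open>
  Fenchel equality at \<open>(u, ystar)\<close> and the subgradient inequality at \<open>(0, y0)\<close> give
  \<open>m \<le> u * (ystar - y0)\<close> for \<^emph>\<open>every\<close> \<open>u\<close> with \<open>(u, ystar)\<close> in the steady-state relation.
  This expression is affine in \<open>u\<close> and in \<open>y0\<close> separately, so on a rectangle its maximum is attained
  at a corner. It remains to see that the procedure brackets \<open>y0\<close> and some such \<open>u\<close>. Each experiment
  intersects the relation with a line of negative slope, and monotonicity orders such an
  intersection coordinatewise against any point of the relation strictly on one side of the line.
\<close>

text \<open>Any two points of a monotone relation are comparable coordinatewise, and
  \<open>u + b * y\<close> with \<open>b > 0\<close> increases in that order, so a strict inequality
  between its values fixes the direction.\<close>

lemma monotone_relation_compare: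
  fixes u1 y1 u2 y2 b :: real
  assumes "monotone_relation k" "(u1, y1) \<in> k" "(u2, y2) \<in> k" "b > 0"
    and "u1 + b * y1 < u2 + b * y2"
  shows "u1 \<le> u2 \<and> y1 \<le> y2"
proof -
  have "u1 < u2 \<Longrightarrow> y1 \<le> y2" "u2 < u1 \<Longrightarrow> y2 \<le> y1"
    using assms(1-3) unfolding monotone_relation_def by blast+
  moreover have "y2 \<le> y1 \<Longrightarrow> b * y2 \<le> b * y1" "y1 < y2 \<or> y2 \<le> y1"
    using \<open>b > 0\<close> by auto
  ultimately show ?thesis
    using assms(5) by (smt (verit))
qed

text \<open>The subgradient at \<open>u\<close> bounds the conjugate by \<open>u * ys - K u\<close>;
  the one at \<open>0\<close> gives \<open>K 0 - K u \<le> - y0 * u\<close>. Membership in the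
  subdifferential makes both values of \<open>K\<close> finite.\<close>

lemma conjugate_bound:
  assumes K: "integral_function K k" and u: "(u, ys) \<in> k" and y0: "(0, y0) \<in> k"
  shows "convex_conjugate K ys + K 0 \<le> ereal (u * (ys - y0))"
proof -
  have sub: "subdifferential K = k"
    using K by (simp add: integral_function_def)
  obtain a where a: "K u = ereal a" and ua: "\<And>v. ereal a + ereal (ys * (v - u)) \<le> K v"
    using u unfolding sub[symmetric] subdifferential_def by (cases "K u") auto
  obtain c where c: "K 0 = ereal c" and uc: "\<And>v. ereal c + ereal (y0 * v) \<le> K v"
    using y0 unfolding sub[symmetric] subdifferential_def by (cases "K 0") auto
  have "convex_conjugate K ys \<le> ereal (u * ys - a)"
    unfolding convex_conjugate_def
  proof (rule SUP_least)
    fix v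
    show "ereal (v * ys) - K v \<le> ereal (u * ys - a)"
      using ua[of v] by (cases "K v") (auto simp: algebra_simps)
  qed
  then have "convex_conjugate K ys + K 0 \<le> ereal (u * ys - a) + ereal c"
    unfolding c by (rule add_right_mono)
  also have "\<dots> \<le> ereal (u * (ys - y0))"
    using uc[of u] by (simp add: a algebra_simps)
  finally show ?thesis .
qed

lemma mult_le_corner:
  fixes u z a b c d M :: real
  assumes "a \<le> u" "u \<le> b" "c \<le> z" "z \<le> d"
    and "a * c \<le> M" "a * d \<le> M" "b * c \<le> M" "b * d \<le> M"
  shows "u * z \<le> M"
proof -
  have end_u: "u * w \<le> M" if "a * w \<le> M" "b * w \<le> M" for w
    using that assms(1,2) mult_right_mono[of u b w] mult_right_mono_neg[of a u w]
    by linarith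
  have "u * c \<le> M" "u * d \<le> M"
    using end_u assms by auto
  then show ?thesis
    using assms(3,4) mult_left_mono[of z d u] mult_left_mono_neg[of c z u]
    by linarith
qed

text \<open>Reduces the analysis of the procedure to two bracketing conditions on the sorted
  measurements.\<close>

lemma le_estimate:
  assumes "sort us = [U1, U2, U3]" "sort ys = [Y1, Y2, Y3]"
    and "if U2 > 0 then Y1 \<le> y \<and> y \<le> Y2 else Y2 \<le> y \<and> y \<le> Y3"
    and "if Y2 > ystar then U1 \<le> u \<and> u \<le> U2 else U2 \<le> u \<and> u \<le> U3"
  shows "u * (ystar - y) \<le> estimate ystar us ys"
proof -
  define c d where "c = (if U2 > 0 then Y1 else Y2)" and "d = (if U2 > 0 then Y2 else Y3)"
  define a b where "a = (if Y2 > ystar then U1 else U2)" and "b = (if Y2 > ystar then U2 else U3)"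
  let ?S = "{\<omega> * (ystar - \<upsilon>) | \<omega> \<upsilon>. \<omega> \<in> {a, b} \<and> \<upsilon> \<in> {c, d}}"
  have est: "estimate ystar us ys = Max ?S"
    using assms(1,2) by (simp add: estimate_def a_def b_def c_def d_def)
  have "?S = {a * (ystar - c), a * (ystar - d), b * (ystar - c), b * (ystar - d)}"
    by auto
  then have corner: "w * (ystar - v) \<le> Max ?S" if "w \<in> {a, b}" "v \<in> {c, d}" for w v
    using that by (intro Max_ge) auto
  have "a \<le> u" "u \<le> b" "ystar - d \<le> ystar - y" "ystar - y \<le> ystar - c"
    using assms(3,4) by (auto simp: a_def b_def c_def d_def split: if_splits)
  then show ?thesis
    unfolding est by (rule mult_le_corner) (use corner in auto)
qed

theorem proposition3:
  fixes \<Sigma> :: "'x::euclidean_space agent"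
    and ustar ystar y0 :: real
  assumes "MEIP \<Sigma>"
    and "(ustar, ystar) \<in> steady_state_relation \<Sigma>"
    and "(0, y0) \<in> steady_state_relation \<Sigma>"
  shows "\<exists>\<beta>0>0. \<exists>R>0. \<forall>\<beta> mm K.
           0 < \<beta> \<longrightarrow> \<beta> < \<beta>0 \<longrightarrow>
           procedure_output \<Sigma> ystar \<beta> R mm \<longrightarrow>
           integral_function K (steady_state_relation \<Sigma>) \<longrightarrow>
           convex_conjugate K ystar + K 0 \<le> ereal mm"
proof -
  define k where "k = steady_state_relation \<Sigma>"
  have mono: "monotone_relation k"
    using assms(1) by (simp add: MEIP_def maximally_monotone_def k_def)
  have star: "(ustar, ystar) \<in> k" and zero: "(0, y0) \<in> k"
    using assms(2,3) by (auto simp: k_def)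
  \<comment> \<open>One constant serves both thresholds: \<open>1 / N\<close> for the gain and
    \<open>N\<close> for the third reference.\<close>
  define N where "N = 1 + \<bar>ustar\<bar> + \<bar>ystar\<bar> + \<bar>y0\<bar>"
  have N: "N > 0" by (simp add: N_def)
  have bound: "convex_conjugate K ystar + K 0 \<le> ereal mm"
    if \<beta>: "0 < \<beta>" "\<beta> < 1 / N" and proc: "procedure_output \<Sigma> ystar \<beta> N mm"
      and K: "integral_function K k" for \<beta> mm K
  proof -
    obtain up yp um ym u2 y2 yref where
      p: "(up, yp) \<in> k" "up + \<beta> * yp = 1" and
      m: "(um, ym) \<in> k" "um + \<beta> * ym = - 1" and
      yref: "if yp < ystar then yref > N else yref < - N" and
      two: "(u2, y2) \<in> k" "u2 + 1 * y2 = yref" and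
      mm: "mm = estimate ystar [um, up, u2] [ym, yp, y2]"
      using proc \<beta>(1) unfolding procedure_output_def measurable_pairs_def k_def[symmetric]
      by (auto simp: algebra_simps)
    have "\<beta> * N < 1"
      using \<beta> N by (simp add: field_simps)
    moreover have "\<beta> * \<bar>ystar\<bar> \<le> \<beta> * N" "\<beta> * \<bar>y0\<bar> \<le> \<beta> * N"
      using \<beta> by (auto simp: N_def)
    ultimately have "\<bar>\<beta> * ystar\<bar> < 1" "\<bar>\<beta> * y0\<bar> < 1"
      using \<beta>(1) unfolding abs_mult by linarith+
    then have small: "\<beta> * ystar < 1" "\<beta> * y0 < 1" "-1 < \<beta> * y0"
      by auto
    \<comment> \<open>\<open>(0, y0)\<close> lies strictly between the parallel lines
      \<open>u + \<beta> * y = -1\<close> and \<open>u + \<beta> * y = 1\<close> of the first two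
      experiments.\<close>
    have p0: "0 \<le> up" "y0 \<le> yp"
      using monotone_relation_compare[OF mono zero p(1) \<beta>(1)] p(2) small by auto
    have m0: "um \<le> 0" "ym \<le> y0"
      using monotone_relation_compare[OF mono m(1) zero \<beta>(1)] m(2) small by auto
    have monoD: "u \<le> u'" if "(u, y) \<in> k" "(u', y') \<in> k" "y < y'" for u y u' y'
      using mono that unfolding monotone_relation_def by (meson not_le)
    have "\<exists>u. (u, ystar) \<in> k \<and> u * (ystar - y0) \<le> mm"
    proof (cases "yp < ystar")
      case True
      then have "ustar + 1 * ystar < u2 + 1 * y2"
        using yref two(2) by (auto simp: N_def)
      then have 2: "ustar \<le> u2" "ystar \<le> y2"
        using monotone_relation_compare[OF mono star two(1) zero_less_one] by auto
      have up: "up \<le> ustar"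
        using monoD[OF p(1) star True] .
      \<comment> \<open>\<open>up = 0\<close> would force \<open>yp = 1 / \<beta> > ystar\<close>.\<close>
      have "\<beta> * yp < \<beta> * ystar"
        using True \<beta>(1) by simp
      then have "up > 0"
        using p(2) small by linarith
      \<comment> \<open>The middle values are \<open>up > 0\<close> and \<open>yp < ystar\<close>,
        which selects \<open>[ym, yp]\<close> for \<open>y0\<close> and \<open>[up, u2]\<close> for
        \<open>ustar\<close>.\<close>
      have "sort [um, up, u2] = [um, up, u2]" "sort [ym, yp, y2] = [ym, yp, y2]"
        using m0 p0 up 2 True by auto
      then have "ustar * (ystar - y0) \<le> mm"
        unfolding mm by (rule le_estimate) (use \<open>up > 0\<close> True m0 p0 up 2 in auto)
      then show ?thesis
        using star by blast
    next
      case False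
      then have "u2 + 1 * y2 < ustar + 1 * ystar" "u2 + 1 * y2 < 0 + 1 * y0"
        using yref two(2) by (auto simp: N_def)
      then have 2: "u2 \<le> ustar" "y2 \<le> ystar" "u2 \<le> 0" "y2 \<le> y0"
        using monotone_relation_compare[OF mono two(1) star zero_less_one]
          monotone_relation_compare[OF mono two(1) zero zero_less_one] by auto
      \<comment> \<open>The middle input is now at most \<open>0\<close>, so the upper two outputs
        are selected, and they enclose \<open>y0\<close>.\<close>
      have sorted: "sort [um, up, u2] = [min um u2, max um u2, up]"
        "sort [ym, yp, y2] = [min ym y2, max ym y2, yp]"
        using m0 p0 2 by (auto simp: min_def max_def)
      \<comment> \<open>If a measured output equals \<open>ystar\<close>, the bracket may miss \<open>ustar\<close> itself but contains
        the measured input, which is then also paired with \<open>ystar\<close>.\<close>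
      obtain u where u: "(u, ystar) \<in> k" and
        brack: "if max ym y2 > ystar then min um u2 \<le> u \<and> u \<le> max um u2
                else max um u2 \<le> u \<and> u \<le> up"
      proof (cases "ym > ystar")
        case True
        then have "ustar \<le> um"
          using monoD[OF star m(1)] by simp
        then show thesis
          using True 2 by (intro that[OF star]) auto
      next
        case le: False
        show thesis
        proof (cases "yp = ystar")
          case True
          show thesis
            using p(1) True le 2 m0 p0 by (intro that[of up]) auto
        next
          case ne: False
          then have "ustar \<le> up"
            using monoD[OF star p(1)] False by simp
          \<comment> \<open>If \<open>ym < ystar\<close>, monotonicity makes this maximum
            \<open>ustar\<close>; if \<open>ym = ystar\<close>, both candidates are paired with
            \<open>ystar\<close>, and the larger one stays above \<open>um\<close>.\<close>
          moreover have "(max um ustar, ystar) \<in> k"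
            using monoD[OF m(1) star] m(1) star le by (cases "ym = ystar") (auto simp: max_def)
          ultimately show thesis
            using le 2 m0 p0 by (intro that[of "max um ustar"]) auto
        qed
      qed
      have "u * (ystar - y0) \<le> mm"
        unfolding mm using sorted
        by (rule le_estimate) (use brack m0 p0 2 in auto)
      then show ?thesis
        using u by blast
    qed
    then obtain u where "(u, ystar) \<in> k" "u * (ystar - y0) \<le> mm"
      by blast
    then show ?thesis
      using conjugate_bound[OF K _ zero] order_trans ereal_less_eq(3) by blast
  qed
  show ?thesis
    by (rule exI[of _ "1 / N"]) (use bound N in \<open>auto simp: k_def\<close>)
qed

end
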